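(* Let $\mathscr{C}$ be an EI category of type $\mathbb{N}$ or $\mathbb{Z}$. For a Grothendieck topology $J$ on $\mathscr{C}^{\mathrm{op}}$ let $\boldsymbol{d}$ be its corresponding function (defined in the context). Then: (1) Via $J \mapsto \boldsymbol{d}$, the Grothendieck topologies $J$ on $\mathscr{C}^{\mathrm{op}}$ such that $J(x)$ does not contain the empty functor for each $x \in \mathrm{Ob}(\mathscr{C})$ are parameterized by (i.e. in bijection with) the functions $\boldsymbol{d}: \mathrm{Ob}(\mathscr{C}) \to \mathbb{N} \cup \{\infty\}$ satisfying the following condition: if $\boldsymbol{d}(n) \neq 0$, then $\boldsymbol{d}(n+1) = \boldsymbol{d}(n) - 1$. (2) Via $J \mapsto \boldsymbol{d}$, all other Grothendieck topologies on $\mathscr{C}^{\mathrm{op}}$ are parameterized by the functions $\boldsymbol{d}: \mathrm{Ob}(\mathscr{C}) \to \mathbb{N} \cup \{-\infty\}$ satisfying the following conditions: $\boldsymbol{d}(n) = -\infty$ for $n \gg 0$; and if $\boldsymbol{d}(n) \neq 0$, then $\boldsymbol{d}(n+1) = \boldsymbol{d}(n) - 1$. (3) A Grothendieck topology $J$ on $\mathscr{C}^{\mathrm{op}}$ is rigid if and only if its corresponding function $\boldsymbol{d}$ satisfies $\boldsymbol{d}(n) \neq \infty$ for all $n \in \mathrm{Ob}(\mathscr{C})$.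
   Context: $\mathbb{N}$ includes $0$; by convention $\infty - 1 = \infty$ and $-\infty - 1 = -\infty$. An EI category is one in which every endomorphism is an isomorphism. An EI category of type $\mathbb{N}$ (resp. type $\mathbb{Z}$) is a small skeletal EI category $\mathscr{C}$ such that: objects are parameterized by $\mathbb{N}$ (resp. $\mathbb{Z}$), and are denoted by $n$; $\mathscr{C}(m,n) \neq \emptyset$ if and only if $m \leqslant n$; $\mathscr{C}(n,n)$ acts transitively (by post-composition) on $\mathscr{C}(m,n)$ for every pair of objects $m, n$; $\mathscr{C}$ is graded with rank function $\deg(f) = n - m \in \mathbb{N}$ for every $f: m \to n$; and morphisms are generated in degrees $0$ and $1$, i.e. every $f: m \to n$ with $n > m$ is a composite of $n - m$ morphisms of degree $1$. A sieve on $x$ in $\mathscr{C}^{\mathrm{op}}$ is a subfunctor $S \subseteq \mathscr{C}(x,-)$ (possibly empty). For $f: x \to y$ put $f^{\ast}(S) = \{ g: y \to \bullet \mid gf \in S\}$. A Grothendieck topology $J$ on $\mathscr{C}^{\mathrm{op}}$ assigns to each object $x$ a collection $J(x)$ of subfunctors of $\mathscr{C}(x,-)$ such that: $\mathscr{C}(x,-) \in J(x)$; $S \in J(x)$ implies $f^{\ast}(S) \in J(y)$ for every $f: x \to y$; and if $S \in J(x)$ and $T \subseteq \mathscr{C}(x,-)$ is a subfunctor with $f^{\ast}(T) \in J(y)$ for every $(f: x \to y) \in S$, then $T \in J(x)$. For an object $n$ and $r \in \mathbb{N}$ let $S(n,r) \subseteq \mathscr{C}(n,-)$ be the subfunctor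 of all morphisms $f: n \to \bullet$ with $\deg(f) \geqslant r$; these are exactly the nonempty subfunctors of $\mathscr{C}(n,-)$. The function $\boldsymbol{d}$ corresponding to $J$ is defined by $\boldsymbol{d}(n) = -\infty$ if $\emptyset \in J(n)$, and $\boldsymbol{d}(n) = \sup\{ r \in \mathbb{N} \mid S(n,r) \in J(n)\}$ otherwise. An object $x$ is $J$-irreducible if $J(x) = \{\mathscr{C}(x,-)\}$. For an object $y$ let $S_y \subseteq \mathscr{C}(y,-)$ be the subfunctor generated by all morphisms of $\mathscr{C}$ from $y$ to $J$-irreducible objects. $J$ is rigid if $S_y \in J(y)$ for every object $y$. *)

theory Defs
  imports Complex_Main "HOL-Library.Extended_Real" "HOL-Library.FuncSet"
begin

section \<open>Categories\<close>

record ('o, 'm) category =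
  Ob :: "'o set"
  Mor :: "'m set"
  Dom :: "'m \<Rightarrow> 'o"
  Cod :: "'m \<Rightarrow> 'o"
  Id :: "'o \<Rightarrow> 'm"
  Comp :: "'m \<Rightarrow> 'm \<Rightarrow> 'm"  (infixl "\<cdot>\<index>" 70)

definition Hom :: "('o, 'm, 'z) category_scheme \<Rightarrow> 'o \<Rightarrow> 'o \<Rightarrow> 'm set" where
  "Hom C x y = {f \<in> Mor C. Dom C f = x \<and> Cod C f = y}"

text \<open>The composite \<open>g \<cdot> f\<close> is first \<open>f\<close>, then \<open>g\<close>. The record fields are total functions;
  their values outside \<open>Ob C\<close>, \<open>Mor C\<close> and the composable pairs carry no meaning.\<close>

locale category =
  fixes C :: "('o, 'm) category" (structure)
  assumes Dom_in: "f \<in> Mor C \<Longrightarrow> Dom C f \<in> Ob C"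
    and Cod_in: "f \<in> Mor C \<Longrightarrow> Cod C f \<in> Ob C"
    and Id_in: "x \<in> Ob C \<Longrightarrow> Id C x \<in> Hom C x x"
    and Comp_in: "f \<in> Hom C x y \<Longrightarrow> g \<in> Hom C y z \<Longrightarrow> g \<cdot> f \<in> Hom C x z"
    and Comp_Id: "f \<in> Hom C x y \<Longrightarrow> f \<cdot> Id C x = f"
    and Id_Comp: "f \<in> Hom C x y \<Longrightarrow> Id C y \<cdot> f = f"
    and Comp_assoc: "f \<in> Hom C w x \<Longrightarrow> g \<in> Hom C x y \<Longrightarrow> h \<in> Hom C y z \<Longrightarrow>
      h \<cdot> (g \<cdot> f) = (h \<cdot> g) \<cdot> f"

definition isomorphism :: "('o, 'm) category \<Rightarrow> 'm \<Rightarrow> bool" where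
  "isomorphism C f \<longleftrightarrow> f \<in> Mor C \<and>
    (\<exists>g \<in> Hom C (Cod C f) (Dom C f).
      g \<cdot>\<^bsub>C\<^esub> f = Id C (Dom C f) \<and> f \<cdot>\<^bsub>C\<^esub> g = Id C (Cod C f))"

definition skeletal :: "('o, 'm) category \<Rightarrow> bool" where
  "skeletal C \<longleftrightarrow> (\<forall>f. isomorphism C f \<longrightarrow> Dom C f = Cod C f)"

locale EI_category = category +
  assumes endo_iso: "f \<in> Hom C x x \<Longrightarrow> isomorphism C f"

section \<open>EI categories of type N and Z\<close>

definition deg :: "(int, 'm) category \<Rightarrow> 'm \<Rightarrow> nat" where
  "deg C f = nat (Cod C f - Dom C f)"

definition rank_function :: "('o, 'm) category \<Rightarrow> ('m \<Rightarrow> nat) \<Rightarrow> bool" where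
  "rank_function C \<rho> \<longleftrightarrow>
    (\<forall>x y z. \<forall>f \<in> Hom C x y. \<forall>g \<in> Hom C y z. \<rho> (g \<cdot>\<^bsub>C\<^esub> f) = \<rho> g + \<rho> f)"

inductive degree_one_composite :: "(int, 'm) category \<Rightarrow> nat \<Rightarrow> 'm \<Rightarrow> bool" for C where
  single: "f \<in> Mor C \<Longrightarrow> deg C f = 1 \<Longrightarrow> degree_one_composite C 1 f"
| step: "degree_one_composite C k f \<Longrightarrow> g \<in> Mor C \<Longrightarrow> Dom C g = Cod C f \<Longrightarrow> deg C g = 1 \<Longrightarrow>
    degree_one_composite C (Suc k) (g \<cdot>\<^bsub>C\<^esub> f)"

text \<open>Objects are integers in both cases: the object set is the set of natural numbers, as a
  subset of the integers, for type N, and all of the integers for type Z.\<close>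

locale EI_category_int = EI_category C for C :: "(int, 'm) category" (structure) +
  assumes skeletal: "skeletal C"
    and Hom_nonempty_iff: "m \<in> Ob C \<Longrightarrow> n \<in> Ob C \<Longrightarrow> Hom C m n \<noteq> {} \<longleftrightarrow> m \<le> n"
    and transitive: "f \<in> Hom C m n \<Longrightarrow> f' \<in> Hom C m n \<Longrightarrow> \<exists>g \<in> Hom C n n. g \<cdot> f = f'"
    and graded: "rank_function C (deg C)"
    and generated: "f \<in> Hom C m n \<Longrightarrow> m < n \<Longrightarrow> degree_one_composite C (nat (n - m)) f"

locale EI_category_type_N = EI_category_int +
  assumes Ob_N: "Ob C = \<nat>"

locale EI_category_type_Z = EI_category_int +
  assumes Ob_Z: "Ob C = UNIV"

section \<open>Grothendieck topologies on the opposite category\<close>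

text \<open>A subfunctor of the representable functor \<open>C(x,-)\<close> is encoded as the set of all its elements.
  No information is lost, since a morphism determines its codomain. In particular the empty
  functor is the empty set.\<close>

definition Hom_from :: "('o, 'm) category \<Rightarrow> 'o \<Rightarrow> 'm set" where
  "Hom_from C x = {f \<in> Mor C. Dom C f = x}"

definition subfunctor :: "('o, 'm) category \<Rightarrow> 'o \<Rightarrow> 'm set \<Rightarrow> bool" where
  "subfunctor C x S \<longleftrightarrow> S \<subseteq> Hom_from C x \<and>
    (\<forall>f \<in> S. \<forall>g \<in> Hom_from C (Cod C f). g \<cdot>\<^bsub>C\<^esub> f \<in> S)"

definition pullback :: "('o, 'm) category \<Rightarrow> 'm \<Rightarrow> 'm set \<Rightarrow> 'm set" where
  "pullback C f S = {g \<in> Hom_from C (Cod C f). g \<cdot>\<^bsub>C\<^esub> f \<in> S}"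

text \<open>Topologies are extensional functions on \<open>Ob C\<close>, so that two topologies are equal exactly if
  they agree at all objects.\<close>

definition grothendieck_topology_op ::
    "('o, 'm) category \<Rightarrow> ('o \<Rightarrow> 'm set set) \<Rightarrow> bool" where
  "grothendieck_topology_op C J \<longleftrightarrow>
    J \<in> (\<Pi>\<^sub>E x \<in> Ob C. Pow {S. subfunctor C x S}) \<and>
    (\<forall>x \<in> Ob C. Hom_from C x \<in> J x) \<and>
    (\<forall>x \<in> Ob C. \<forall>S \<in> J x. \<forall>f \<in> Hom_from C x. pullback C f S \<in> J (Cod C f)) \<and>
    (\<forall>x \<in> Ob C. \<forall>S \<in> J x. \<forall>T. subfunctor C x T \<and>
      (\<forall>f \<in> S. pullback C f T \<in> J (Cod C f)) \<longrightarrow> T \<in> J x)"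

definition irreducible_object :: "('o, 'm) category \<Rightarrow> ('o \<Rightarrow> 'm set set) \<Rightarrow> 'o \<Rightarrow> bool" where
  "irreducible_object C J x \<longleftrightarrow> x \<in> Ob C \<and> J x = {Hom_from C x}"

definition rigid :: "('o, 'm) category \<Rightarrow> ('o \<Rightarrow> 'm set set) \<Rightarrow> bool" where
  "rigid C J \<longleftrightarrow> (\<forall>y \<in> Ob C.
    subfunctor C y hull {f \<in> Hom_from C y. irreducible_object C J (Cod C f)} \<in> J y)"

section \<open>The function of a topology\<close>

definition deg_at_least :: "(int, 'm) category \<Rightarrow> int \<Rightarrow> nat \<Rightarrow> 'm set" where
  "deg_at_least C n r = {f \<in> Hom_from C n. deg C f \<ge> r}"

definition topology_function ::
    "(int, 'm) category \<Rightarrow> (int \<Rightarrow> 'm set set) \<Rightarrow> int \<Rightarrow> ereal" where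
  "topology_function C J = (\<lambda>n \<in> Ob C.
    if {} \<in> J n then -\<infinity>
    else Sup {ereal (real r) | r. deg_at_least C n r \<in> J n})"

definition ereal_nats :: "ereal set" where
  "ereal_nats = range (\<lambda>k::nat. ereal (real k))"

end

theory Submission
  imports Defs
begin

text \<open>By transitivity, every nonempty subfunctor of \<open>C(n,-)\<close> is some \<open>S(n,r)\<close>, and the pullback of
  \<open>S(n,r)\<close> along a morphism of degree \<open>k\<close> is \<open>S(n+k,r-k)\<close>. Hence \<open>J(n)\<close> is determined by \<open>d(n)\<close>: it
  consists of all subfunctors if \<open>d(n) = -\<infinity>\<close>, and of the \<open>S(n,r)\<close> with \<open>r \<le> d(n)\<close> otherwise. The
  axioms of a topology amount to the recurrence for \<open>d\<close>, so all topologies correspond to all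
  functions with values in \<open>\<nat> \<union> {\<infinity>, -\<infinity>}\<close> satisfying it. The recurrence propagates both
  \<open>\<infinity>\<close> and \<open>-\<infinity>\<close> to all larger objects, so a function takes at most one of these two values, which
  gives the two cases. Finally, \<open>n\<close> is irreducible iff \<open>d(n) = 0\<close>: if \<open>d(n) = k\<close> is finite then \<open>n + k\<close>
  is irreducible, and if \<open>d(n) = \<infinity>\<close> then no irreducible object receives a morphism from \<open>n\<close>.\<close>

section \<open>Topologies and subfunctors over an arbitrary category\<close>

lemma grothendieck_topology_opD:
  assumes "grothendieck_topology_op C J"
  shows topology_extensional: "J \<in> extensional (Ob C)"
    and topology_subfunctor: "x \<in> Ob C \<Longrightarrow> S \<in> J x \<Longrightarrow> subfunctor C x S"
    and topology_Hom_from: "x \<in> Ob C \<Longrightarrow> Hom_from C x \<in> J x"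
    and topology_pullback:
      "x \<in> Ob C \<Longrightarrow> S \<in> J x \<Longrightarrow> f \<in> Hom_from C x \<Longrightarrow> pullback C f S \<in> J (Cod C f)"
    and topology_transitive:
      "x \<in> Ob C \<Longrightarrow> S \<in> J x \<Longrightarrow> subfunctor C x T \<Longrightarrow>
        (\<And>f. f \<in> S \<Longrightarrow> pullback C f T \<in> J (Cod C f)) \<Longrightarrow> T \<in> J x"
proof -
  note J = assms[unfolded grothendieck_topology_op_def]
  show "J \<in> extensional (Ob C)"
    using J by (simp add: PiE_def)
  show "subfunctor C x S" if "x \<in> Ob C" "S \<in> J x"
    using PiE_mem[OF conjunct1[OF J] that(1)] that(2) by blast
  show "Hom_from C x \<in> J x" if "x \<in> Ob C"
    using J that by (elim conjE) (rule bspec)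
  show "pullback C f S \<in> J (Cod C f)" if "x \<in> Ob C" "S \<in> J x" "f \<in> Hom_from C x"
    using J that by (elim conjE) (drule bspec, assumption)+
  show "T \<in> J x" if x: "x \<in> Ob C" "S \<in> J x" "subfunctor C x T"
    and loc: "\<And>f. f \<in> S \<Longrightarrow> pullback C f T \<in> J (Cod C f)"
  proof -
    have "\<forall>x \<in> Ob C. \<forall>S \<in> J x. \<forall>T. subfunctor C x T \<and>
        (\<forall>f \<in> S. pullback C f T \<in> J (Cod C f)) \<longrightarrow> T \<in> J x"
      using J by (elim conjE)
    from bspec[OF bspec[OF this x(1)] x(2)] show ?thesis
      using x(3) loc by blast
  qed
qed

context category
begin

lemma comp_Hom_from:
  assumes "f \<in> Hom_from C x" and "g \<in> Hom_from C (Cod C f)"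
  shows "g \<cdot> f \<in> Hom_from C x" and "Cod C (g \<cdot> f) = Cod C g"
  using Comp_in[of f x "Cod C f" g "Cod C g"] assms by (auto simp: Hom_from_def Hom_def)

lemma subfunctor_Hom_from: "subfunctor C x (Hom_from C x)"
  by (auto simp: subfunctor_def comp_Hom_from)

lemma subfunctor_hull:
  assumes "A \<subseteq> Hom_from C x"
  shows "subfunctor C x (subfunctor C x hull A)"
proof (subst subfunctor_def, intro conjI ballI)
  \<comment> \<open>The hull is an intersection; the representable functor is one of the subfunctors
    containing \<open>A\<close>, so the intersection is not taken over an empty family.\<close>
  show "subfunctor C x hull A \<subseteq> Hom_from C x"
    by (rule hull_minimal) (fact assms subfunctor_Hom_from)+
  fix f g assume "f \<in> subfunctor C x hull A" "g \<in> Hom_from C (Cod C f)"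
  then show "g \<cdot> f \<in> subfunctor C x hull A"
    by (auto simp: hull_def subfunctor_def)
qed

lemma subfunctor_pullback:
  assumes "subfunctor C x S" and f: "f \<in> Hom_from C x"
  shows "subfunctor C (Cod C f) (pullback C f S)"
  unfolding subfunctor_def
proof (intro conjI ballI)
  show "pullback C f S \<subseteq> Hom_from C (Cod C f)"
    by (auto simp: pullback_def)
  fix g h assume g: "g \<in> pullback C f S" and h: "h \<in> Hom_from C (Cod C g)"
  have g': "g \<in> Hom_from C (Cod C f)" "g \<cdot> f \<in> S"
    using g by (auto simp: pullback_def)
  have "h \<cdot> (g \<cdot> f) \<in> S"
    using assms(1) g' h comp_Hom_from(2)[OF f g'(1)] by (auto simp: subfunctor_def)
  moreover have "h \<cdot> (g \<cdot> f) = (h \<cdot> g) \<cdot> f"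
    using f g' h by (intro Comp_assoc) (auto simp: Hom_from_def Hom_def)
  ultimately show "h \<cdot> g \<in> pullback C f S"
    using comp_Hom_from(1)[OF g'(1) h] by (simp add: pullback_def)
qed

text \<open>Local character is tested on the cover \<open>S\<close>: each \<open>f\<close> in
  \<open>S\<close> already lies in \<open>T\<close>, so \<open>T\<close> pulls back along
  \<open>f\<close> to the whole representable functor.\<close>

lemma topology_upward_closed:
  assumes J: "grothendieck_topology_op C J" and x: "x \<in> Ob C"
    and S: "S \<in> J x" and T: "subfunctor C x T" and "S \<subseteq> T"
  shows "T \<in> J x"
proof (rule topology_transitive[OF J x S T])
  fix f assume "f \<in> S"
  then have f: "f \<in> Hom_from C x" and "f \<in> T"
    using topology_subfunctor[OF J x S] \<open>S \<subseteq> T\<close> by (auto simp: subfunctor_def)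
  then have "pullback C f T = Hom_from C (Cod C f)"
    using T by (auto simp: pullback_def subfunctor_def)
  moreover have "Cod C f \<in> Ob C"
    using f by (auto simp: Hom_from_def Cod_in)
  ultimately show "pullback C f T \<in> J (Cod C f)"
    using topology_Hom_from[OF J] by simp
qed

end

section \<open>Subfunctors of representables and their degrees\<close>

locale EI_category_ray = EI_category_int +
  \<comment> \<open>Both object sets, the naturals and all integers, are closed upward; this common
    property lets one argument treat both types.\<close>
  assumes Ob_upward: "m \<in> Ob C \<Longrightarrow> m \<le> n \<Longrightarrow> n \<in> Ob C"
begin

lemma Hom_fromD:
  assumes "f \<in> Hom_from C n"
  shows "f \<in> Hom C n (Cod C f)" "n \<in> Ob C" "Cod C f \<in> Ob C" "n \<le> Cod C f"
    "Cod C f = n + int (deg C f)"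
proof -
  show 1: "f \<in> Hom C n (Cod C f)" "n \<in> Ob C" "Cod C f \<in> Ob C"
    using assms Dom_in Cod_in by (auto simp: Hom_from_def Hom_def)
  then show "n \<le> Cod C f"
    using Hom_nonempty_iff by blast
  then show "Cod C f = n + int (deg C f)"
    using assms by (auto simp: deg_def Hom_from_def)
qed

lemma ex_morphism:
  assumes "n \<in> Ob C"
  obtains f where "f \<in> Hom_from C n" "Cod C f = n + int k" "deg C f = k"
proof -
  have "Hom C n (n + int k) \<noteq> {}"
    using Hom_nonempty_iff assms Ob_upward by simp
  then show ?thesis
    using that by (fastforce simp: Hom_def Hom_from_def deg_def)
qed

lemma deg_comp:
  assumes "f \<in> Hom_from C n" and "g \<in> Hom_from C (Cod C f)"
  shows "deg C (g \<cdot> f) = deg C g + deg C f"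
  using graded assms Hom_fromD(1) unfolding rank_function_def by blast

text \<open>Any \<open>u\<close> from the codomain of \<open>f\<close> to that of \<open>h\<close>
  makes \<open>u \<cdot> f\<close> parallel to \<open>h\<close>. Transitivity supplies an
  endomorphism carrying \<open>u \<cdot> f\<close> to \<open>h\<close>, and a subfunctor is closed
  under both compositions.\<close>

lemma subfunctor_deg_closed:
  assumes S: "subfunctor C n S" and f: "f \<in> S" and h: "h \<in> Hom_from C n"
    and le: "deg C f \<le> deg C h"
  shows "h \<in> S"
proof -
  have f': "f \<in> Hom_from C n"
    using S f by (auto simp: subfunctor_def)
  have "Cod C f \<le> Cod C h"
    using Hom_fromD(5)[OF f'] Hom_fromD(5)[OF h] le by simp
  then obtain u where u: "u \<in> Hom C (Cod C f) (Cod C h)"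
    using Hom_nonempty_iff[OF Hom_fromD(3)[OF f'] Hom_fromD(3)[OF h]] by blast
  then have u': "u \<in> Hom_from C (Cod C f)" "Cod C u = Cod C h"
    by (auto simp: Hom_def Hom_from_def)
  have uf: "u \<cdot> f \<in> S"
    using S f u' by (auto simp: subfunctor_def)
  have "u \<cdot> f \<in> Hom C n (Cod C h)"
    using Comp_in[OF Hom_fromD(1)[OF f'] u] .
  then obtain g where g: "g \<in> Hom C (Cod C h) (Cod C h)" "g \<cdot> (u \<cdot> f) = h"
    using transitive Hom_fromD(1)[OF h] by blast
  then have "g \<in> Hom_from C (Cod C (u \<cdot> f))"
    using comp_Hom_from(2)[OF f' u'(1)] u'(2) by (auto simp: Hom_def Hom_from_def)
  then show ?thesis
    using S uf g(2) by (auto simp: subfunctor_def)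
qed

lemma subfunctor_deg_at_least: "subfunctor C n (deg_at_least C n r)"
  by (auto simp: subfunctor_def deg_at_least_def comp_Hom_from deg_comp)

lemma deg_at_least_0: "deg_at_least C n 0 = Hom_from C n"
  by (simp add: deg_at_least_def)

lemma deg_at_least_subset_iff:
  assumes "n \<in> Ob C"
  shows "deg_at_least C n r \<subseteq> deg_at_least C n s \<longleftrightarrow> s \<le> r"
proof
  obtain f where "f \<in> Hom_from C n" "deg C f = r"
    using ex_morphism[OF assms] by blast
  then show "s \<le> r" if "deg_at_least C n r \<subseteq> deg_at_least C n s"
    using that by (auto simp: deg_at_least_def)
qed (auto simp: deg_at_least_def)

lemma deg_at_least_eq_iff:
  assumes "n \<in> Ob C"
  shows "deg_at_least C n r = deg_at_least C n s \<longleftrightarrow> r = s"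
  using deg_at_least_subset_iff[OF assms] by (metis order_antisym order_refl)

lemma deg_at_least_nonempty:
  assumes "n \<in> Ob C"
  shows "deg_at_least C n r \<noteq> {}"
proof -
  obtain f where "f \<in> Hom_from C n" "deg C f = r"
    using ex_morphism[OF assms] by blast
  then show ?thesis
    by (auto simp: deg_at_least_def)
qed

text \<open>If \<open>S\<close> is nonempty, \<open>r\<close> is the least degree occurring in it: a
  morphism of that degree forces all morphisms of degree at least \<open>r\<close> into
  \<open>S\<close>.\<close>

lemma subfunctor_cases:
  assumes S: "subfunctor C n S"
  obtains "S = {}" | r where "S = deg_at_least C n r"
proof (cases "S = {}")
  case False
  define r where "r = (LEAST r. \<exists>f\<in>S. deg C f = r)"
  have "\<exists>r. \<exists>f\<in>S. deg C f = r"
    using False by auto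
  then have "\<exists>f\<in>S. deg C f = r"
    unfolding r_def by (rule LeastI_ex)
  moreover have "r \<le> deg C f" if "f \<in> S" for f
    unfolding r_def using that by (intro Least_le) auto
  ultimately have "S = deg_at_least C n r"
    using S subfunctor_deg_closed[OF S] unfolding deg_at_least_def subfunctor_def by blast
  then show ?thesis
    by (rule that(2))
qed (use that in simp)

text \<open>Degrees add under composition. Truncated subtraction is intended: once
  \<open>deg C f\<close> reaches \<open>r\<close>, the pullback is the whole representable
  functor.\<close>

lemma pullback_deg_at_least:
  assumes "f \<in> Hom_from C n"
  shows "pullback C f (deg_at_least C n r) = deg_at_least C (Cod C f) (r - deg C f)"
  using assms by (auto simp: pullback_def deg_at_least_def comp_Hom_from deg_comp)

lemma pullback_empty: "pullback C f {} = {}"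
  by (simp add: pullback_def)

end

section \<open>From a topology to its function\<close>

locale topology_on_ray = EI_category_ray +
  fixes J
  assumes J: "grothendieck_topology_op C J"
begin

abbreviation "d \<equiv> topology_function C J"

lemma empty_upward:
  assumes "n \<in> Ob C" "n \<le> m" "{} \<in> J n"
  shows "{} \<in> J m"
  using topology_pullback[OF J assms(1,3)] ex_morphism[OF assms(1), of "nat (m - n)"] assms(2)
  by (metis pullback_empty add.commute diff_add_cancel diff_ge_0_iff_ge int_nat_eq)

text \<open>Emptiness also descends: every morphism in the cover \<open>S(n,r)\<close> ends at or
  above \<open>n + r\<close>, where the empty functor covers, so local character applies. This keeps
  \<open>d\<close> from jumping to \<open>-\<infinity>\<close> right after a positive value.\<close>

lemma empty_of_deg_at_least:
  assumes n: "n \<in> Ob C" and r: "deg_at_least C n r \<in> J n" and m: "{} \<in> J (n + int r)"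
  shows "{} \<in> J n"
proof (rule topology_transitive[OF J n r])
  fix f assume "f \<in> deg_at_least C n r"
  then have "n + int r \<le> Cod C f"
    using Hom_fromD(5) by (fastforce simp: deg_at_least_def)
  then show "pullback C f {} \<in> J (Cod C f)"
    using empty_upward[OF _ _ m] Ob_upward[OF n] by (simp add: pullback_empty)
qed (simp add: subfunctor_def)

lemma deg_at_least_antimono:
  assumes n: "n \<in> Ob C" and r: "deg_at_least C n r \<in> J n" and "s \<le> r"
  shows "deg_at_least C n s \<in> J n"
  using topology_upward_closed[OF J n r subfunctor_deg_at_least] deg_at_least_subset_iff[OF n] assms(3)
  by simp

lemma deg_at_least_0_in:
  assumes "n \<in> Ob C"
  shows "deg_at_least C n 0 \<in> J n"
  using topology_Hom_from[OF J assms] by (simp add: deg_at_least_0)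

text \<open>The set of admissible \<open>r\<close> is downward closed and contains 0, hence is an
  initial segment with maximum \<open>k\<close> or all naturals. Later arguments use this
  description of membership in place of the supremum.\<close>

lemma topology_function_cases:
  assumes n: "n \<in> Ob C"
  obtains (empty) "{} \<in> J n" "d n = -\<infinity>" "\<And>S. subfunctor C n S \<Longrightarrow> S \<in> J n"
  | (finite) k where "{} \<notin> J n" "d n = ereal (real k)" "\<And>r. deg_at_least C n r \<in> J n \<longleftrightarrow> r \<le> k"
  | (infinite) "{} \<notin> J n" "d n = \<infinity>" "\<And>r. deg_at_least C n r \<in> J n"
proof -
  let ?R = "{r. deg_at_least C n r \<in> J n}"
  have d: "d n = (if {} \<in> J n then -\<infinity> else (SUP r\<in>?R. ereal (real r)))"
    using n by (simp add: topology_function_def setcompr_eq_image)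
  consider "{} \<in> J n" | "{} \<notin> J n" "finite ?R" | "{} \<notin> J n" "infinite ?R"
    by blast
  then show ?thesis
  proof cases
    case 1
    then show ?thesis
      using d empty topology_upward_closed[OF J n 1] by simp
  next
    case 2
    have "Max ?R \<in> ?R"
      using 2(2) deg_at_least_0_in[OF n] by (intro Max_in) auto
    then have R: "deg_at_least C n r \<in> J n \<longleftrightarrow> r \<le> Max ?R" for r
      using Max_ge[OF 2(2)] deg_at_least_antimono[OF n] by blast
    then have "?R = {..Max ?R}"
      by blast
    moreover have "(SUP r\<in>{..k}. ereal (real r)) = ereal (real k)" for k
      by (rule antisym) (auto intro: SUP_least SUP_upper)
    ultimately have "d n = ereal (real (Max ?R))"
      using d 2(1) by metis
    then show ?thesis
      using finite 2(1) R by blast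
  next
    case 3
    have R: "deg_at_least C n r \<in> J n" for r
      using 3(2) deg_at_least_antimono[OF n] unfolding infinite_nat_iff_unbounded
      by (metis (lifting) mem_Collect_eq less_imp_le)
    have "(SUP r::nat. ereal (real r)) = \<infinity>"
      by (rule SUP_PInfty) auto
    then have "d n = \<infinity>"
      using d 3(1) R by simp
    then show ?thesis
      using infinite 3(1) R by blast
  qed
qed

lemma topology_function_eq_finite:
  assumes n: "n \<in> Ob C" and "{} \<notin> J n" and k: "\<And>r. deg_at_least C n r \<in> J n \<longleftrightarrow> r \<le> k"
  shows "d n = ereal (real k)"
  using n
proof (cases rule: topology_function_cases)
  case (finite l)
  then have "l = k"
    using k by (metis order_antisym order_refl)
  then show ?thesis
    using finite(2) by simp
next
  case infinite
  then show ?thesis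
    using k[of "Suc k"] by simp
qed (use assms in simp)

lemma topology_function_eq_infinity:
  assumes n: "n \<in> Ob C" and "{} \<notin> J n" and k: "\<And>r. deg_at_least C n r \<in> J n"
  shows "d n = \<infinity>"
  using n
proof (cases rule: topology_function_cases)
  case (finite l)
  then show ?thesis
    using k[of "Suc l"] by simp
qed (use assms in simp_all)

text \<open>One direction pulls back along a morphism of degree 1; the other is local character on
  the cover \<open>S(n,1)\<close>.\<close>

lemma deg_at_least_Suc_iff:
  assumes n: "n \<in> Ob C" and 1: "deg_at_least C n 1 \<in> J n"
  shows "deg_at_least C n (Suc r) \<in> J n \<longleftrightarrow> deg_at_least C (n + 1) r \<in> J (n + 1)"
proof
  obtain f where f: "f \<in> Hom_from C n" "Cod C f = n + 1" "deg C f = 1"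
    using ex_morphism[OF n, of 1] by auto
  show "deg_at_least C (n + 1) r \<in> J (n + 1)" if "deg_at_least C n (Suc r) \<in> J n"
    using topology_pullback[OF J n that f(1)] pullback_deg_at_least[OF f(1)] f by simp
next
  assume r: "deg_at_least C (n + 1) r \<in> J (n + 1)"
  have n1: "n + 1 \<in> Ob C"
    using Ob_upward[OF n] by simp
  show "deg_at_least C n (Suc r) \<in> J n"
  proof (rule topology_transitive[OF J n 1 subfunctor_deg_at_least])
    fix f assume "f \<in> deg_at_least C n 1"
    then have f: "f \<in> Hom_from C n" and "1 \<le> deg C f"
      by (auto simp: deg_at_least_def)
    \<comment> \<open>Nothing relates \<open>g\<close> to \<open>f\<close> beyond codomain and
      degree. This suffices, because the pullback of a degree subfunctor depends only on these: both
      pullbacks below are cut off at \<open>Suc r - deg C f\<close>.\<close>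
    obtain g where g: "g \<in> Hom_from C (n + 1)" "Cod C g = Cod C f" "deg C g = deg C f - 1"
      using ex_morphism[OF n1, of "deg C f - 1"] Hom_fromD(5)[OF f] \<open>1 \<le> deg C f\<close>
      by (auto simp: of_nat_diff)
    have "pullback C f (deg_at_least C n (Suc r)) = pullback C g (deg_at_least C (n + 1) r)"
      using \<open>1 \<le> deg C f\<close> by (simp add: pullback_deg_at_least[OF f] pullback_deg_at_least[OF g(1)] g)
    then show "pullback C f (deg_at_least C n (Suc r)) \<in> J (Cod C f)"
      using topology_pullback[OF J n1 r g(1)] g(2) by simp
  qed
qed

lemma topology_function_recurrence:
  assumes n: "n \<in> Ob C" and "d n \<noteq> 0"
  shows "d (n + 1) = d n - 1"
proof -
  have n1: "n + 1 \<in> Ob C"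
    using Ob_upward[OF n] by simp
  from n show ?thesis
  proof (cases rule: topology_function_cases)
    case empty
    then have "{} \<in> J (n + 1)"
      using empty_upward[OF n] by simp
    then show ?thesis
      using empty(2) n1 by (simp add: topology_function_def[of C J] one_ereal_def)
  next
    case (finite k)
    then obtain l where k: "k = Suc l"
      using \<open>d n \<noteq> 0\<close> by (cases k) auto
    \<comment> \<open>A nonzero value makes \<open>S(n,1)\<close> a cover. Then an empty cover at
      \<open>n + 1\<close> would descend to \<open>n\<close>, and cutoffs at \<open>n\<close> and
      \<open>n + 1\<close> correspond with a shift by one.\<close>
    then have 1: "deg_at_least C n 1 \<in> J n"
      using finite(3) by simp
    then have "{} \<notin> J (n + 1)"
      using empty_of_deg_at_least[OF n 1] finite(1) by auto
    moreover have "deg_at_least C (n + 1) r \<in> J (n + 1) \<longleftrightarrow> r \<le> l" for r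
      using deg_at_least_Suc_iff[OF n 1, of r] finite(3) k by simp
    ultimately have "d (n + 1) = ereal (real l)"
      by (intro topology_function_eq_finite[OF n1]) auto
    then show ?thesis
      using finite(2) k by (simp add: one_ereal_def del: One_nat_def)
  next
    case infinite
    have "{} \<notin> J (n + 1)"
      using empty_of_deg_at_least[OF n infinite(3), of 1] infinite(1) by auto
    moreover have "deg_at_least C (n + 1) r \<in> J (n + 1)" for r
      using deg_at_least_Suc_iff[OF n infinite(3), of r] infinite(3) by simp
    ultimately have "d (n + 1) = \<infinity>"
      by (intro topology_function_eq_infinity[OF n1]) auto
    then show ?thesis
      using infinite(2) by simp
  qed
qed

end

definition recurrent_functions :: "(int, 'm) category \<Rightarrow> (int \<Rightarrow> ereal) set" where
  "recurrent_functions C = {d \<in> Ob C \<rightarrow>\<^sub>E (ereal_nats \<union> {\<infinity>, -\<infinity>}).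
    \<forall>n \<in> Ob C. d n \<noteq> 0 \<longrightarrow> d (n + 1) = d n - 1}"

text \<open>The value \<open>-\<infinity>\<close> lies below every natural number yet stands for the
  largest collection, hence its own disjunct; only through it can the empty functor enter.\<close>

definition topology_of_function ::
    "(int, 'm) category \<Rightarrow> (int \<Rightarrow> ereal) \<Rightarrow> int \<Rightarrow> 'm set set" where
  "topology_of_function C d = (\<lambda>n \<in> Ob C. {S. subfunctor C n S \<and>
    (d n = -\<infinity> \<or> (\<exists>r. S = deg_at_least C n r \<and> ereal (real r) \<le> d n))})"

lemma (in topology_on_ray) topology_function_recurrent: "d \<in> recurrent_functions C"
proof -
  have "d n \<in> ereal_nats \<union> {\<infinity>, -\<infinity>}" if "n \<in> Ob C" for n
    by (cases rule: topology_function_cases[OF that]) (auto simp: ereal_nats_def)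
  moreover have "d \<in> extensional (Ob C)"
    by (simp add: topology_function_def)
  ultimately show ?thesis
    by (auto simp: recurrent_functions_def PiE_def topology_function_recurrence)
qed

text \<open>A subfunctor is empty or \<open>S(n,r)\<close> for a unique \<open>r\<close>, and in
  each case its membership in \<open>J n\<close> can be read off \<open>d n\<close>.\<close>

lemma (in topology_on_ray) topology_of_topology_function: "topology_of_function C d = J"
proof (rule extensionalityI[OF _ topology_extensional[OF J]])
  fix n assume n: "n \<in> Ob C"
  have "S \<in> J n \<longleftrightarrow> subfunctor C n S \<and>
      (d n = -\<infinity> \<or> (\<exists>r. S = deg_at_least C n r \<and> ereal (real r) \<le> d n))" for S
  proof (cases "subfunctor C n S")
    case True
    then show ?thesis
    proof (cases rule: subfunctor_cases)
      case 1
      show ?thesis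
        using 1 True deg_at_least_nonempty[OF n]
        by (cases rule: topology_function_cases[OF n]) auto
    next
      case (2 r)
      show ?thesis
        using 2 True deg_at_least_eq_iff[OF n]
        by (cases rule: topology_function_cases[OF n]) auto
    qed
  qed (use topology_subfunctor[OF J n] in blast)
  then show "topology_of_function C d n = J n"
    using n by (auto simp: topology_of_function_def)
qed (simp add: topology_of_function_def)

section \<open>From a function to a topology\<close>

locale recurrent_function_on_ray = EI_category_ray +
  fixes d
  assumes recurrent: "d \<in> recurrent_functions C"
begin

lemma recurrence: "n \<in> Ob C \<Longrightarrow> d n \<noteq> 0 \<Longrightarrow> d (n + 1) = d n - 1"
  using recurrent by (simp add: recurrent_functions_def)

lemma value_cases:
  assumes "n \<in> Ob C"
  obtains "d n = -\<infinity>" | "d n = \<infinity>" | k where "d n = ereal (real k)"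
  using recurrent assms by (auto simp: recurrent_functions_def ereal_nats_def PiE_def Pi_def)

lemma minus_infinity_upward:
  assumes "n \<in> Ob C" "n \<le> m" "d n = -\<infinity>"
  shows "d m = -\<infinity>"
  using \<open>n \<le> m\<close>
proof (induction m rule: int_ge_induct)
  case (step m)
  then show ?case
    using recurrence[of m] Ob_upward[OF assms(1)] by (simp add: one_ereal_def)
qed (fact assms)

lemma infinity_upward:
  assumes "n \<in> Ob C" "n \<le> m" "d n = \<infinity>"
  shows "d m = \<infinity>"
  using \<open>n \<le> m\<close>
proof (induction m rule: int_ge_induct)
  case (step m)
  then show ?case
    using recurrence[of m] Ob_upward[OF assms(1)] by (simp add: one_ereal_def)
qed (fact assms)

lemma countdown:
  assumes "n \<in> Ob C" "d n = ereal (real k)" "j \<le> k"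
  shows "d (n + int j) = ereal (real (k - j))"
  using \<open>j \<le> k\<close>
proof (induction j)
  case (Suc j)
  \<comment> \<open>The induction step assumes \<open>Suc j \<le> k\<close>, so the value here is
    still nonzero and the recurrence applies.\<close>
  then have "d (n + int j) = ereal (real (k - j))" "k - j \<noteq> 0"
    by simp_all
  then show ?case
    using recurrence[of "n + int j"] Ob_upward[OF assms(1)] Suc.prems
    by (simp add: one_ereal_def of_nat_diff algebra_simps)
qed (simp add: assms)

text \<open>The object where the countdown ends: it tests local character for finite values and
  later provides the irreducible target for rigidity.\<close>

lemma zero_at:
  assumes "n \<in> Ob C" "d n = ereal (real k)"
  shows "d (n + int k) = 0"
  using countdown[OF assms order_refl] by simp

text \<open>This is stability under pullback in numerical form, \<open>S(n,r)\<close> pulling back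
  to \<open>S(n+j,r-j)\<close>.\<close>

lemma lower_bound_upward:
  assumes n: "n \<in> Ob C" and "ereal (real r) \<le> d n"
  shows "d (n + int j) = -\<infinity> \<or> ereal (real (r - j)) \<le> d (n + int j)"
proof -
  have nj: "n + int j \<in> Ob C"
    using Ob_upward[OF n] by simp
  show ?thesis
  proof (cases rule: value_cases[OF n])
    case 1
    then show ?thesis
      using assms(2) by simp
  next
    case 2
    then show ?thesis
      using infinity_upward[OF n] by simp
  next
    case (3 k)
    show ?thesis
    proof (cases "j \<le> k")
      case True
      then show ?thesis
        using countdown[OF n 3] assms(2) 3 by simp
    next
      \<comment> \<open>Past the zero the recurrence says nothing, but \<open>r \<le> k < j\<close>
        truncates \<open>r - j\<close> to 0, which every value other than
        \<open>-\<infinity>\<close> dominates.\<close>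
      case False
      then show ?thesis
        using assms(2) 3 by (cases rule: value_cases[OF nj]) auto
    qed
  qed
qed

abbreviation "J \<equiv> topology_of_function C d"

lemma topology_of_function_iff:
  assumes "n \<in> Ob C"
  shows "S \<in> J n \<longleftrightarrow> subfunctor C n S \<and>
    (d n = -\<infinity> \<or> (\<exists>r. S = deg_at_least C n r \<and> ereal (real r) \<le> d n))"
  using assms by (simp add: topology_of_function_def)

lemma topology_topology_of_function: "grothendieck_topology_op C J"
  unfolding grothendieck_topology_op_def
proof (intro conjI ballI allI impI)
  show "J \<in> (\<Pi>\<^sub>E x \<in> Ob C. Pow {S. subfunctor C x S})"
    by (auto simp: topology_of_function_def)
next
  fix n assume n: "n \<in> Ob C"
  have "d n = -\<infinity> \<or> ereal (real 0) \<le> d n"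
    by (cases rule: value_cases[OF n]) auto
  then show "Hom_from C n \<in> J n"
    unfolding topology_of_function_iff[OF n]
    using subfunctor_Hom_from deg_at_least_0 by metis
next
  fix n S f
  assume n: "n \<in> Ob C" and S: "S \<in> J n" and f: "f \<in> Hom_from C n"
  have sub: "subfunctor C (Cod C f) (pullback C f S)"
    using S subfunctor_pullback[OF _ f] by (simp add: topology_of_function_iff[OF n])
  from S consider "d n = -\<infinity>" | r where "S = deg_at_least C n r" "ereal (real r) \<le> d n"
    by (auto simp: topology_of_function_iff[OF n])
  then show "pullback C f S \<in> J (Cod C f)"
  proof cases
    case 1
    then show ?thesis
      using minus_infinity_upward[OF n Hom_fromD(4)[OF f]] sub
      by (simp add: topology_of_function_iff[OF Hom_fromD(3)[OF f]])
  next
    case 2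
    then show ?thesis
      using lower_bound_upward[OF n 2(2), of "deg C f"] sub pullback_deg_at_least[OF f]
      by (auto simp: topology_of_function_iff[OF Hom_fromD(3)[OF f]] simp flip: Hom_fromD(5)[OF f])
  qed
next
  fix n S T
  assume n: "n \<in> Ob C" and S: "S \<in> J n"
    and "subfunctor C n T \<and> (\<forall>f\<in>S. pullback C f T \<in> J (Cod C f))"
  then have T: "subfunctor C n T" and loc: "\<And>f. f \<in> S \<Longrightarrow> pullback C f T \<in> J (Cod C f)"
    by auto
  show "T \<in> J n"
  proof (cases "d n = -\<infinity>")
    case True
    then show ?thesis
      using T by (simp add: topology_of_function_iff[OF n])
  next
    case False
    then obtain r where r: "S = deg_at_least C n r" "ereal (real r) \<le> d n"
      using S by (auto simp: topology_of_function_iff[OF n])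
    have "\<exists>t. T = deg_at_least C n t \<and> ereal (real t) \<le> d n"
    proof (cases rule: value_cases[OF n])
      case 2
      \<comment> \<open>With \<open>d n = \<infinity>\<close> it is enough that \<open>T\<close> is
        nonempty. One morphism of \<open>S\<close> decides this, since its codomain again has value
        \<open>\<infinity>\<close> and hence only nonempty covers.\<close>
      obtain f where f: "f \<in> Hom_from C n" "deg C f = r"
        using ex_morphism[OF n] by blast
      then have "pullback C f T \<in> J (Cod C f)"
        using r by (intro loc) (simp add: deg_at_least_def)
      moreover have "d (Cod C f) = \<infinity>"
        using infinity_upward[OF n Hom_fromD(4)[OF f(1)]] 2 by simp
      ultimately have "pullback C f T \<noteq> {}"
        using topology_of_function_iff[OF Hom_fromD(3)[OF f(1)]]
          deg_at_least_nonempty[OF Hom_fromD(3)[OF f(1)]]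
        by (metis MInfty_neq_PInfty(1))
      then have "T \<noteq> {}"
        by (auto simp: pullback_def)
      then show ?thesis
        using 2 by (cases rule: subfunctor_cases[OF T]) auto
    next
      case (3 k)
      \<comment> \<open>Degree \<open>k\<close> is chosen so that \<open>f\<close> lies in
        \<open>S\<close>, as \<open>r \<le> k\<close>, and ends where \<open>d\<close> vanishes.
        There only the whole functor covers, so the pullback of \<open>T\<close> contains the
        identity and \<open>f\<close> itself lies in \<open>T\<close>.\<close>
      obtain f where f: "f \<in> Hom_from C n" "Cod C f = n + int k" "deg C f = k"
        using ex_morphism[OF n] by blast
      then have "pullback C f T \<in> J (Cod C f)"
        using r 3 by (intro loc) (simp add: deg_at_least_def)
      moreover have "d (Cod C f) = 0"
        using zero_at[OF n 3] f(2) by simp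
      ultimately have "pullback C f T = Hom_from C (Cod C f)"
        using topology_of_function_iff[OF Hom_fromD(3)[OF f(1)]] deg_at_least_0 by auto
      moreover have "Id C (Cod C f) \<in> Hom_from C (Cod C f)"
        using Id_in[OF Hom_fromD(3)[OF f(1)]] by (auto simp: Hom_def Hom_from_def)
      ultimately have "f \<in> T"
        using Id_Comp[OF Hom_fromD(1)[OF f(1)]] unfolding pullback_def
        by (metis (no_types, lifting) mem_Collect_eq)
      with T f(3) 3 show ?thesis
        by (cases rule: subfunctor_cases) (auto simp: deg_at_least_def)
    qed (use False in simp)
    then show ?thesis
      using T by (simp add: topology_of_function_iff[OF n])
  qed
qed

lemma topology_function_of_topology: "topology_function C J = d"
proof (rule extensionalityI)
  fix n assume n: "n \<in> Ob C"
  \<comment> \<open>The constructed topology is itself subject to the earlier analysis, so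
    membership of the \<open>S(n,r)\<close> determines its function without a new supremum
    computation.\<close>
  interpret topology_on_ray C J
    by unfold_locales (rule topology_topology_of_function)
  have empty: "{} \<in> J n \<longleftrightarrow> d n = -\<infinity>"
    using deg_at_least_nonempty[OF n]
    by (auto simp: topology_of_function_iff[OF n] subfunctor_def)
  have deg: "deg_at_least C n r \<in> J n \<longleftrightarrow> ereal (real r) \<le> d n" if "d n \<noteq> -\<infinity>" for r
    using that deg_at_least_eq_iff[OF n] subfunctor_deg_at_least
    by (auto simp: topology_of_function_iff[OF n])
  show "topology_function C J n = d n"
  proof (cases rule: value_cases[OF n])
    case 1
    then show ?thesis
      using empty n by (simp add: topology_function_def)
  next
    case 2
    then show ?thesis
      using empty deg topology_function_eq_infinity[OF n] by simp
  next
    case (3 k)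
    then show ?thesis
      using empty deg topology_function_eq_finite[OF n, of k] by simp
  qed
qed (use recurrent in \<open>auto simp: topology_function_def recurrent_functions_def PiE_def\<close>)

text \<open>Otherwise both infinite values would propagate to \<open>max n m\<close>.\<close>

lemma at_most_one_infinity:
  assumes "n \<in> Ob C" "m \<in> Ob C" "d n = -\<infinity>"
  shows "d m \<noteq> \<infinity>"
  using minus_infinity_upward[OF assms(1) _ assms(3), of "max n m"]
    infinity_upward[OF assms(2), of "max n m"]
  by auto

end

section \<open>The bijection and its two halves\<close>

context EI_category_ray
begin

lemma bij_betw_topology_function:
  "bij_betw (topology_function C) {J. grothendieck_topology_op C J} (recurrent_functions C)"
proof (rule bij_betw_byWitness[where f' = "topology_of_function C"])
  have top: "topology_on_ray C J" if "grothendieck_topology_op C J" for J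
    using that by unfold_locales
  have fn: "recurrent_function_on_ray C d" if "d \<in> recurrent_functions C" for d
    using that by unfold_locales
  show "\<forall>J\<in>{J. grothendieck_topology_op C J}. topology_of_function C (topology_function C J) = J"
    using topology_on_ray.topology_of_topology_function[OF top] by blast
  show "\<forall>d\<in>recurrent_functions C. topology_function C (topology_of_function C d) = d"
    using recurrent_function_on_ray.topology_function_of_topology[OF fn] by blast
  show "topology_function C ` {J. grothendieck_topology_op C J} \<subseteq> recurrent_functions C"
    using topology_on_ray.topology_function_recurrent[OF top] by blast
  show "topology_of_function C ` recurrent_functions C \<subseteq> {J. grothendieck_topology_op C J}"
    using recurrent_function_on_ray.topology_topology_of_function[OF fn] by blast
qed

lemma recurrent_functions_never_minus_infinity:
  "{d \<in> recurrent_functions C. \<forall>n \<in> Ob C. d n \<noteq> -\<infinity>} =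
    {d \<in> Ob C \<rightarrow>\<^sub>E (ereal_nats \<union> {\<infinity>}). \<forall>n \<in> Ob C. d n \<noteq> 0 \<longrightarrow> d (n + 1) = d n - 1}"
proof -
  have "d n \<in> ereal_nats \<union> {\<infinity>, -\<infinity>} \<and> d n \<noteq> -\<infinity> \<longleftrightarrow> d n \<in> ereal_nats \<union> {\<infinity>}"
    for d :: "int \<Rightarrow> ereal" and n
    by (auto simp: ereal_nats_def)
  then show ?thesis
    unfolding recurrent_functions_def PiE_def Pi_def by blast
qed

lemma recurrent_functions_eventually_minus_infinity:
  assumes "Ob C \<noteq> {}"
  shows "{d \<in> recurrent_functions C. \<not> (\<forall>n \<in> Ob C. d n \<noteq> -\<infinity>)} =
    {d \<in> Ob C \<rightarrow>\<^sub>E (ereal_nats \<union> {-\<infinity>}). (\<forall>\<^sub>F n in at_top. d n = -\<infinity>) \<and>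
      (\<forall>n \<in> Ob C. d n \<noteq> 0 \<longrightarrow> d (n + 1) = d n - 1)}" (is "?L = ?R")
proof (intro equalityI subsetI)
  fix d assume "d \<in> ?L"
  then obtain n where d: "d \<in> recurrent_functions C" and n: "n \<in> Ob C" "d n = -\<infinity>"
    by auto
  interpret recurrent_function_on_ray C d
    by unfold_locales (fact d)
  have "\<forall>\<^sub>F m in at_top. d m = -\<infinity>"
    using minus_infinity_upward[OF n(1) _ n(2)] by (auto simp: eventually_at_top_linorder)
  moreover have "d \<in> Ob C \<rightarrow>\<^sub>E (ereal_nats \<union> {-\<infinity>})"
    using d at_most_one_infinity[OF n(1) _ n(2)]
    by (auto simp: recurrent_functions_def PiE_def Pi_def)
  ultimately show "d \<in> ?R"
    using d by (simp add: recurrent_functions_def)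
next
  fix d assume d: "d \<in> ?R"
  obtain n N where "n \<in> Ob C" "\<forall>m\<ge>N. d m = -\<infinity>"
    using d assms by (auto simp: eventually_at_top_linorder)
  \<comment> \<open>The threshold \<open>N\<close> ranges over all integers and may lie outside the
    object set; the maximum with an object does not.\<close>
  then have "max n N \<in> Ob C" "d (max n N) = -\<infinity>"
    using Ob_upward by auto
  moreover have "d \<in> recurrent_functions C"
    using d by (auto simp: recurrent_functions_def PiE_def Pi_def)
  ultimately show "d \<in> ?L"
    by blast
qed

end

section \<open>Irreducible objects and rigidity\<close>

context topology_on_ray
begin

lemma minus_infinity_iff: "n \<in> Ob C \<Longrightarrow> d n = -\<infinity> \<longleftrightarrow> {} \<in> J n"
  by (cases n rule: topology_function_cases) auto

text \<open>A nonzero value yields a cover other than the whole functor: the empty one for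
  \<open>-\<infinity>\<close>, \<open>S(n,k)\<close> for \<open>k > 0\<close>, and
  \<open>S(n,1)\<close> for \<open>\<infinity>\<close>.\<close>

lemma irreducible_iff:
  assumes n: "n \<in> Ob C"
  shows "irreducible_object C J n \<longleftrightarrow> d n = 0"
proof
  assume "irreducible_object C J n"
  then have *: "S \<in> J n \<longleftrightarrow> S = deg_at_least C n 0" for S
    by (auto simp: irreducible_object_def deg_at_least_0)
  show "d n = 0"
    using n
  proof (cases rule: topology_function_cases)
    case empty
    then show ?thesis
      using * deg_at_least_nonempty[OF n, of 0] by simp
  next
    case (finite k)
    then have "deg_at_least C n k = deg_at_least C n 0"
      using * by blast
    then show ?thesis
      using finite(2) deg_at_least_eq_iff[OF n] by simp
  next
    case infinite
    then have "deg_at_least C n 1 = deg_at_least C n 0"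
      using * by blast
    then show ?thesis
      using deg_at_least_eq_iff[OF n] by simp
  qed
next
  assume 0: "d n = 0"
  have "J n = {deg_at_least C n 0}"
  proof (intro equalityI subsetI)
    fix S assume S: "S \<in> J n"
    from topology_subfunctor[OF J n S] show "S \<in> {deg_at_least C n 0}"
      using S 0 by (cases rule: subfunctor_cases; cases rule: topology_function_cases[OF n]) auto
  qed (use deg_at_least_0_in[OF n] in simp)
  then show "irreducible_object C J n"
    using n by (simp add: irreducible_object_def deg_at_least_0)
qed

lemma rigid_iff: "rigid C J \<longleftrightarrow> (\<forall>n \<in> Ob C. d n \<noteq> \<infinity>)"
proof -
  interpret recurrent_function_on_ray C d
    by unfold_locales (rule topology_function_recurrent)
  let ?A = "\<lambda>n. {f \<in> Hom_from C n. irreducible_object C J (Cod C f)}"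
  have "subfunctor C n hull ?A n \<in> J n \<longleftrightarrow> d n \<noteq> \<infinity>" if n: "n \<in> Ob C" for n
  proof -
    have sub: "subfunctor C n (subfunctor C n hull ?A n)"
      by (rule subfunctor_hull) auto
    from n show ?thesis
    proof (cases rule: topology_function_cases)
      case empty
      then show ?thesis
        using sub by simp
    next
      case (finite k)
      \<comment> \<open>This \<open>f\<close> reaches the irreducible object \<open>n + k\<close>.
        The subfunctor it generates contains \<open>S(n,k)\<close>, which is a cover.\<close>
      obtain f where f: "f \<in> Hom_from C n" "Cod C f = n + int k" "deg C f = k"
        using ex_morphism[OF n] by blast
      then have "irreducible_object C J (Cod C f)"
        using zero_at[OF n finite(2)] irreducible_iff[OF Hom_fromD(3)[OF f(1)]] by simp
      then have "f \<in> subfunctor C n hull ?A n"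
        using f(1) by (auto intro: hull_inc)
      then have "deg_at_least C n k \<subseteq> subfunctor C n hull ?A n"
        using subfunctor_deg_closed[OF sub] f(3) by (auto simp: deg_at_least_def)
      then show ?thesis
        using topology_upward_closed[OF J n _ sub, of "deg_at_least C n k"] finite by simp
    next
      case infinite
      \<comment> \<open>The value \<open>\<infinity>\<close> persists at all targets, so none is
        irreducible. The generated subfunctor is then empty, and the empty functor is not a cover
        here.\<close>
      have "?A n = {}"
        using infinity_upward[OF n Hom_fromD(4) infinite(2)] irreducible_iff[OF Hom_fromD(3)] by auto
      then have "subfunctor C n hull ?A n \<subseteq> {}"
        by (intro hull_minimal) (auto simp: subfunctor_def)
      then show ?thesis
        using infinite by simp
    qed
  qed
  then show ?thesis
    by (simp add: rigid_def)
qed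

end

section \<open>The classification for both types\<close>

theorem theorem1p7:
  fixes C :: "(int, 'm) category"
  assumes "EI_category_type_N C \<or> EI_category_type_Z C"
  shows
    "bij_betw (topology_function C)
       {J. grothendieck_topology_op C J \<and> (\<forall>x \<in> Ob C. {} \<notin> J x)}
       {d \<in> Ob C \<rightarrow>\<^sub>E (ereal_nats \<union> {\<infinity>}).
          \<forall>n \<in> Ob C. d n \<noteq> 0 \<longrightarrow> d (n + 1) = d n - 1}
   \<and> bij_betw (topology_function C)
       {J. grothendieck_topology_op C J \<and> \<not> (\<forall>x \<in> Ob C. {} \<notin> J x)}
       {d \<in> Ob C \<rightarrow>\<^sub>E (ereal_nats \<union> {-\<infinity>}).
          (\<forall>\<^sub>F n in at_top. d n = -\<infinity>) \<and>
          (\<forall>n \<in> Ob C. d n \<noteq> 0 \<longrightarrow> d (n + 1) = d n - 1)}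
   \<and> (\<forall>J. grothendieck_topology_op C J \<longrightarrow>
       (rigid C J \<longleftrightarrow> (\<forall>n \<in> Ob C. topology_function C J n \<noteq> \<infinity>)))"
proof -
  have int: "EI_category_int C"
    using assms by (auto simp only: EI_category_type_N_def EI_category_type_Z_def)
  have "(\<nat> :: int set) = {0..}"
    by (auto simp: Nats_def image_iff zero_le_imp_eq_int)
  then have "Ob C = {0..} \<or> Ob C = UNIV"
    using assms EI_category_type_N.Ob_N EI_category_type_Z.Ob_Z by metis
  then have 0: "0 \<in> Ob C" and up: "m \<in> Ob C \<Longrightarrow> m \<le> n \<Longrightarrow> n \<in> Ob C" for m n
    by (metis UNIV_I atLeast_iff order_refl order_trans)+
  interpret EI_category_ray C
    using int up unfolding EI_category_ray_def EI_category_ray_axioms_def by blast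
  have top: "topology_on_ray C J" if "grothendieck_topology_op C J" for J
    using that by unfold_locales
  \<comment> \<open>This matches the splitting condition on topologies with one on functions, so the
    bijection restricts to each half and to its complement.\<close>
  have empty: "(\<forall>n \<in> Ob C. topology_function C J n \<noteq> -\<infinity>) \<longleftrightarrow> (\<forall>n \<in> Ob C. {} \<notin> J n)"
    if "grothendieck_topology_op C J" for J
    using topology_on_ray.minus_infinity_iff[OF top] that by auto
  have nonempty: "Ob C \<noteq> {}"
    using 0 by blast
  have "bij_betw (topology_function C)
      {J \<in> {J. grothendieck_topology_op C J}. \<forall>n \<in> Ob C. {} \<notin> J n}
      {d \<in> recurrent_functions C. \<forall>n \<in> Ob C. d n \<noteq> -\<infinity>}"
    by (rule bij_betw_Collect[OF bij_betw_topology_function]) (use empty in blast)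
  moreover have "bij_betw (topology_function C)
      {J \<in> {J. grothendieck_topology_op C J}. \<not> (\<forall>n \<in> Ob C. {} \<notin> J n)}
      {d \<in> recurrent_functions C. \<not> (\<forall>n \<in> Ob C. d n \<noteq> -\<infinity>)}"
    by (rule bij_betw_Collect[OF bij_betw_topology_function]) (use empty in blast)
  ultimately show ?thesis
    using topology_on_ray.rigid_iff[OF top]
    unfolding mem_Collect_eq recurrent_functions_never_minus_infinity
      recurrent_functions_eventually_minus_infinity[OF nonempty]
    by blast
qed

end
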